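(* For every integer $n\ge0$ and arbitrary (complex, or indeterminate) parameters $s,t$, the second-order $(s,t)$-Eulerian polynomials $B_n^{(s,t)}$ satisfy, as an identity of power series in $x$, $$\frac{x\,e^{x(s-1)}\,B_n^{(s,t)}(x)}{(1-x)^{2n+s+t}}=\sum_{k\ge1}\frac{(xe^{-x})^k}{(k-1)!}\sum_{j=0}^{k-1}\binom{k-1}{j}\,(s+t)^{\overline{j}}\,(s+j)\,(k+s-1)^{n+k-j-2}.$$
   Context: The second-order $(s,t)$-Eulerian numbers are defined by $$E^{(2)}_{(s,t)}(n,k)=(k+s)\,E^{(2)}_{(s,t)}(n-1,k)+(2n-k+t-1)\,E^{(2)}_{(s,t)}(n-1,k-1)+\delta_{k0}\delta_{n0},$$ with $E^{(2)}_{(s,t)}(n,k)=0$ if $n<0$ or $k<0$, and the second-order $(s,t)$-Eulerian polynomials are $B_n^{(s,t)}(x)=\sum_{k=0}^nE^{(2)}_{(s,t)}(n,k)\,x^k$. Notation: $x^{\overline{j}}=x(x+1)\cdots(x+j-1)$ is the raising factorial (equal to $1$ for $j=0$). The power $(1-x)^{-a}$ is understood as its binomial series $\sum_{j\ge0}\frac{a^{\overline{j}}}{j!}x^j$. Conventions: $0^0=1$; a negative exponent occurs only when $n=0$ and $j=k-1$, where the product $(s+j)(k+s-1)^{n+k-j-2}=(s+k-1)(s+k-1)^{-1}$ is read as $1$, also when $s+k-1=0$. *)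

theory Defs
  imports "HOL-Computational_Algebra.Computational_Algebra"
begin

text \<open>
  Second-order \<open>(s,t)\<close>-Eulerian numbers.  The entries with a negative index vanish, so the
  recurrence only involves the entries below; the Kronecker delta contributes at \<open>(0,0)\<close> only.
\<close>

fun eulerian2 :: "'a::field_char_0 \<Rightarrow> 'a \<Rightarrow> nat \<Rightarrow> nat \<Rightarrow> 'a" where
  "eulerian2 s t 0 0 = 1"
| "eulerian2 s t 0 (Suc k) = 0"
| "eulerian2 s t (Suc n) 0 = (of_nat 0 + s) * eulerian2 s t n 0"
| "eulerian2 s t (Suc n) (Suc k) =
     (of_nat (Suc k) + s) * eulerian2 s t n (Suc k)
     + (2 * of_nat (Suc n) - of_nat (Suc k) + t - 1) * eulerian2 s t n k"

definition eulerian2_poly :: "'a::field_char_0 \<Rightarrow> 'a \<Rightarrow> nat \<Rightarrow> 'a poly" where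
  "eulerian2_poly s t n = (\<Sum>k=0..n. monom (eulerian2 s t n k) k)"

text \<open>The power \<open>(1 - x)\<close> to the exponent \<open>-a\<close>, as a binomial series.\<close>

definition one_minus_X_neg_powr :: "'a::field_char_0 \<Rightarrow> 'a fps" where
  "one_minus_X_neg_powr a = Abs_fps (\<lambda>j. pochhammer a j / fact j)"

text \<open>
  The product \<open>(s + j) (k + s - 1)\<close> to the \<open>n + k - j - 2\<close>, for \<open>k \<ge> 1\<close> and \<open>j \<le> k - 1\<close>.
  The exponent is negative (namely \<open>-1\<close>) only if \<open>n = 0\<close> and \<open>j = k - 1\<close>, where the
  product is read as \<open>1\<close>; otherwise the subtraction on \<open>nat\<close> does not truncate.
\<close>

definition abel_factor :: "'a::field_char_0 \<Rightarrow> nat \<Rightarrow> nat \<Rightarrow> nat \<Rightarrow> 'a" where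
  "abel_factor s n k j =
     (if n = 0 \<and> j = k - 1 then 1
      else (s + of_nat j) * (of_nat k + s - 1) ^ (n + k - j - 2))"

definition series_term :: "'a::field_char_0 \<Rightarrow> 'a \<Rightarrow> nat \<Rightarrow> nat \<Rightarrow> 'a fps" where
  "series_term s t n k =
     fps_const (1 / fact (k - 1)) * (fps_X * fps_exp (- 1)) ^ k
     * fps_const (\<Sum>j=0..k - 1. of_nat ((k - 1) choose j) * pochhammer (s + t) j * abel_factor s n k j)"

end

theory Submission
  imports Defs
begin

text \<open>
  Put \<open>y = X exp (-X)\<close> and let \<open>F n\<close> (\<open>eulerian2_series s t n\<close>) be the closed
  form, the left-hand side of the identity.
  The right-hand side is a power series \<open>A n\<close>
  (\<open>abel_series s t n\<close>) in \<open>y\<close>, so the claim is that \<open>F n = A n oo y\<close>.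
  Because \<open>y' = (1 - X) exp (-X)\<close>, the Euler operator \<open>y d/dy\<close> is \<open>X / (1 - X) d/dX\<close>
  (lemma \<open>compose_theta\<close>).  On the right, passing from \<open>n\<close> to \<open>n + 1\<close> multiplies the
  coefficient of \<open>y^k\<close> by \<open>k + s - 1\<close>, that is, applies the operator \<open>y d/dy + (s - 1)\<close>
  (lemma \<open>abel_series_Suc\<close>); on the left, the recurrence of the Eulerian numbers says that
  the same operator takes \<open>F n\<close> to \<open>F (n + 1)\<close> (lemma \<open>eulerian2_series_Suc\<close>).  So only
  \<open>n = 0\<close> remains.

  For \<open>n = 0\<close>, expand \<open>(1 - X)^-(s+t)\<close> in its binomial series.  Its \<open>j\<close>-th term contributes a
  multiple of \<open>X^(j+1) exp ((s-1) X) = y^(j+1) exp ((s+j) X)\<close>, and the Abel series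
  \<open>exp (c X) = (\<Sum>m. c (c + m)^(m-1) y^m / m!)\<close> (lemma \<open>abel_exp_compose_tree_arg\<close>) at
  \<open>c = s + j\<close> turns this into a series in \<open>y\<close>.  Collecting the terms with \<open>m + j + 1 = k\<close>
  gives the inner sum of the identity.
\<close>

section \<open>Power series in a series without constant term\<close>

text \<open>
  Only the terms up to \<open>b ^ N\<close> reach the coefficient at \<open>N\<close>, so each coefficient of the
  partial sums is eventually constant.  The summation starts at the first power.
\<close>

lemma fps_compose_sums_shifted:
  fixes a b :: "'a::comm_ring_1 fps"
  assumes "a $ 0 = 0" "b $ 0 = 0"
  shows "(\<lambda>k. fps_const (a $ Suc k) * b ^ Suc k) sums (a oo b)"
  unfolding sums_def
proof (rule tendsto_fpsI)
  fix N
  have "(\<Sum>k<K. fps_const (a $ Suc k) * b ^ Suc k) $ N = (a oo b) $ N" if "K \<ge> N" for K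
  proof -
    have "(\<Sum>k<K. fps_const (a $ Suc k) * b ^ Suc k) $ N = (\<Sum>k<K. a $ Suc k * (b ^ Suc k) $ N)"
      by (simp only: fps_sum_nth fps_mult_left_const_nth)
    also have "\<dots> = (\<Sum>i\<le>K. a $ i * (b ^ i) $ N)"
      by (simp add: sum.atMost_shift assms(1) del: power_Suc)
    also have "\<dots> = (\<Sum>i\<in>{0..N}. a $ i * (b ^ i) $ N)"
      using that assms(2) by (intro sum.mono_neutral_right) (auto simp: startsby_zero_power_prefix)
    finally show ?thesis
      by (simp add: fps_compose_nth)
  qed
  then show "\<forall>\<^sub>F K in sequentially. (\<Sum>k<K. fps_const (a $ Suc k) * b ^ Suc k) $ N = (a oo b) $ N"
    by (auto intro: eventually_sequentiallyI)
qed

section \<open>The substitution of X exp(-X)\<close>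

text \<open>
  The series \<open>y\<close>.  Its compositional inverse is the exponential generating function of rooted
  labelled trees.
\<close>

definition tree_arg :: "'a::field_char_0 fps" where
  "tree_arg = fps_X * fps_exp (- 1)"

lemma tree_arg_nth_0 [simp]: "tree_arg $ 0 = 0"
  by (simp add: tree_arg_def)

lemma tree_arg_nth_1 [simp]: "tree_arg $ Suc 0 = 1"
  by (simp add: tree_arg_def)

lemma fps_deriv_tree_arg: "fps_deriv tree_arg = (1 - fps_X) * fps_exp (- 1)"
  by (simp add: tree_arg_def algebra_simps flip: fps_const_neg)

lemma tree_arg_mult_exp: "tree_arg * fps_exp c = fps_X * fps_exp (c - 1)"
  using fps_exp_add_mult[of "-1" c] by (simp add: tree_arg_def mult.assoc)

lemma compose_tree_arg_cancel: "f oo tree_arg = g oo tree_arg \<longleftrightarrow> f = g"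
  using fps_compose_inj_right[of tree_arg f g] by simp

lemma compose_tree_arg_surj: "(f oo fps_inv tree_arg) oo tree_arg = (f :: 'a::field_char_0 fps)"
proof -
  have "fps_inv tree_arg $ 0 = (0 :: 'a)"
    by (simp add: fps_inv_def)
  then show ?thesis
    by (simp add: fps_inv flip: fps_compose_assoc)
qed

text \<open>
  The Euler operator in the variable \<open>y\<close> is \<open>X / (1 - X)\<close> times the derivative, cleared of
  its denominator here.
\<close>

lemma compose_theta:
  "(1 - fps_X) * ((fps_X * fps_deriv f) oo tree_arg) = fps_X * fps_deriv (f oo tree_arg)"
proof -
  have "(fps_X * fps_deriv f) oo tree_arg = fps_X * fps_exp (- 1) * (fps_deriv f oo tree_arg)"
    by (simp add: fps_compose_mult_distrib flip: tree_arg_def)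
  then show ?thesis
    by (simp add: fps_compose_deriv fps_deriv_tree_arg mult_ac)
qed

section \<open>The Abel series of an exponential\<close>

text \<open>
  The quotient \<open>c (c + m)^(m-1)\<close> at \<open>m = 0\<close> is \<open>1\<close> by definition, so that \<open>c = 0\<close> gives the
  constant series \<open>1\<close>, as it must for \<open>exp 0\<close>.
\<close>

definition abel_exp :: "'a::field_char_0 \<Rightarrow> 'a fps" where
  "abel_exp c = Abs_fps (\<lambda>m. if m = 0 then 1 else c * (c + of_nat m) ^ (m - 1) / fact m)"

lemma one_minus_X_inverse: "(1 - fps_X) * inverse (1 - fps_X :: 'a::field_char_0 fps) = 1"
  by (rule inverse_mult_eq_1') simp

text \<open>
  Let \<open>E c\<close> and \<open>V c\<close> be \<open>exp (c X)\<close> and \<open>exp (c X) / (1 - X)\<close> written as series in \<open>y\<close>;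
  they exist since \<open>y\<close> has a compositional inverse.  As \<open>X exp (c X) = y exp ((c + 1) X)\<close>,
  they satisfy \<open>E' c = c V (c + 1)\<close> and \<open>V c = E c + X V (c + 1)\<close>.  With the constant
  term \<open>1\<close> of \<open>E c\<close>, these equations determine all coefficients, simultaneously for all \<open>c\<close>, and the Abel coefficients \<open>c (c + N)^(N-1) / N!\<close>
  together with \<open>(c + N)^N / N!\<close> solve them.
\<close>

lemma abel_exp_compose_tree_arg: "abel_exp c oo tree_arg = fps_exp c"
proof -
  let ?I = "inverse (1 - fps_X) :: 'a fps"
  define E where "E c = fps_exp c oo fps_inv tree_arg" for c :: 'a
  define V where "V c = (fps_exp c * ?I) oo fps_inv tree_arg" for c :: 'a
  have E: "E c oo tree_arg = fps_exp c" and V: "V c oo tree_arg = fps_exp c * ?I" for c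
    unfolding E_def V_def by (rule compose_tree_arg_surj)+
  have dE: "fps_deriv (E c) = fps_const c * V (c + 1)" for c
  proof -
    have "(fps_deriv (E c) oo tree_arg) * fps_deriv tree_arg = fps_deriv (E c oo tree_arg)"
      by (simp add: fps_compose_deriv)
    also have "\<dots> = fps_const c * fps_exp c"
      by (simp add: E)
    also have "fps_exp c = fps_exp (c + 1) * fps_exp (- 1)"
      by (simp flip: fps_exp_add_mult)
    also have "fps_const c * \<dots> = fps_const c * (fps_exp (c + 1) * fps_exp (- 1)) * ((1 - fps_X) * ?I)"
      by (simp only: one_minus_X_inverse mult_1_right)
    also have "\<dots> = fps_const c * (V (c + 1) oo tree_arg) * fps_deriv tree_arg"
      by (simp only: V fps_deriv_tree_arg mult_ac)
    finally have "fps_deriv (E c) oo tree_arg = fps_const c * (V (c + 1) oo tree_arg)"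
      by (subst (asm) mult_right_cancel) (auto simp: fps_deriv_tree_arg fps_eq_iff intro!: exI[of _ 0])
    then have "fps_deriv (E c) oo tree_arg = (fps_const c * V (c + 1)) oo tree_arg"
      by (simp add: fps_compose_mult_distrib)
    then show ?thesis
      by (simp only: compose_tree_arg_cancel)
  qed
  have V_eq: "V c = E c + fps_X * V (c + 1)" for c
  proof -
    have "(E c + fps_X * V (c + 1)) oo tree_arg = fps_exp c + tree_arg * (fps_exp (c + 1) * ?I)"
      by (simp add: fps_compose_add_distrib fps_compose_mult_distrib E V)
    also have "\<dots> = fps_exp c * ((1 - fps_X) * ?I) + fps_X * fps_exp c * ?I"
      using tree_arg_mult_exp[of "c + 1"] by (simp add: one_minus_X_inverse mult.assoc[symmetric])
    also have "\<dots> = V c oo tree_arg"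
      by (simp add: V algebra_simps)
    finally show ?thesis
      by (simp only: compose_tree_arg_cancel)
  qed
  have "E c $ N = abel_exp c $ N \<and> V c $ N = (c + of_nat N) ^ N / fact N" for N c
  proof (induction N arbitrary: c)
    case 0
    have "E c $ 0 = 1"
      by (simp add: E_def)
    then show ?case
      using arg_cong[OF V_eq, of "\<lambda>f. f $ 0", of c] by (simp add: abel_exp_def)
  next
    case (Suc N)
    let ?u = "c + of_nat (Suc N)"
    have V_IH: "V (c + 1) $ N = ?u ^ N / fact N"
      using Suc.IH[of "c + 1"] by (simp add: algebra_simps)
    have "of_nat (Suc N) * E c $ Suc N = c * V (c + 1) $ N"
      using arg_cong[OF dE, of "\<lambda>f. f $ N", of c] by simp
    then have E_Suc: "E c $ Suc N = c * ?u ^ N / fact (Suc N)"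
      unfolding V_IH by (simp add: field_simps del: of_nat_Suc)
    have "V c $ Suc N = c * ?u ^ N / fact (Suc N) + ?u ^ N / fact N"
      using arg_cong[OF V_eq, of "\<lambda>f. f $ Suc N", of c] 
      by (simp add: E_Suc V_IH del: of_nat_Suc fact_Suc)
    also have "\<dots> = ?u ^ Suc N / fact (Suc N)"
      by (simp add: divide_simps del: of_nat_Suc) (simp add: algebra_simps)
    finally show ?case
      using E_Suc by (simp add: abel_exp_def)
  qed
  then have "E c = abel_exp c"
    by (simp add: fps_eq_iff)
  with E show ?thesis
    by metis
qed

section \<open>The recurrence of the closed form\<close>

lemma one_minus_X_neg_powr_nth [simp]:
  "one_minus_X_neg_powr a $ j = pochhammer a j / fact j"
  by (simp add: one_minus_X_neg_powr_def)

lemma fps_deriv_one_minus_X_neg_powr: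
  "fps_deriv (one_minus_X_neg_powr a) = fps_const a * one_minus_X_neg_powr (a + 1)"
  by (simp add: fps_eq_iff pochhammer_rec field_simps del: of_nat_Suc)

lemma one_minus_X_neg_powr_plus_1:
  "one_minus_X_neg_powr a = (1 - fps_X) * one_minus_X_neg_powr (a + 1)"
proof (rule fps_ext)
  fix j
  show "one_minus_X_neg_powr a $ j = ((1 - fps_X) * one_minus_X_neg_powr (a + 1)) $ j"
  proof (cases j)
    case (Suc i)
    have "pochhammer a (Suc i) = a * pochhammer (a + 1) i"
      by (rule pochhammer_rec)
    moreover have "pochhammer (a + 1) (Suc i) = (a + 1 + of_nat i) * pochhammer (a + 1) i"
      by (rule pochhammer_rec')
    moreover have "of_nat (Suc i) \<noteq> (0 :: 'a)"
      by (rule of_nat_neq_0)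
    ultimately show ?thesis
      by (simp only: Suc left_diff_distrib mult_1_left fps_sub_nth fps_X_mult_nth
          one_minus_X_neg_powr_nth)
        (simp add: divide_simps del: of_nat_Suc, simp add: algebra_simps)
  qed simp
qed

lemma eulerian2_eq_0: "k > n \<Longrightarrow> eulerian2 s t n k = 0"
  by (induction s t n k rule: eulerian2.induct) auto

lemma fps_of_eulerian2_poly_nth [simp]:
  "fps_of_poly (eulerian2_poly s t n) $ k = eulerian2 s t n k"
  by (simp add: eulerian2_poly_def coeff_sum eulerian2_eq_0)

lemma fps_of_eulerian2_poly_Suc:
  fixes s t :: "'a::field_char_0"
  defines "B \<equiv> \<lambda>n. fps_of_poly (eulerian2_poly s t n)"
  shows "B (Suc n) = fps_X * (1 - fps_X) * fps_deriv (B n) + fps_const s * B n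
           + fps_const (2 * of_nat n + t) * (fps_X * B n)"
proof (rule fps_ext)
  fix k
  have B_nth: "B m $ i = eulerian2 s t m i" for m i
    by (simp only: B_def fps_of_eulerian2_poly_nth)
  have split: "fps_X * (1 - fps_X) * fps_deriv (B n)
      = fps_X * fps_deriv (B n) - fps_X * (fps_X * fps_deriv (B n))"
    by (simp add: algebra_simps)
  show "B (Suc n) $ k = (fps_X * (1 - fps_X) * fps_deriv (B n) + fps_const s * B n
           + fps_const (2 * of_nat n + t) * (fps_X * B n)) $ k"
  proof (cases k)
    case 0
    then show ?thesis
      unfolding split by (simp add: B_nth)
  next
    case (Suc i)
    have "(fps_X * fps_deriv (B n)) $ i = of_nat i * eulerian2 s t n i"
      by (cases i) (simp_all add: B_nth)
    then show ?thesis
      unfolding split Suc by (simp add: B_nth fps_X_mult_nth algebra_simps)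
  qed
qed

definition eulerian2_series :: "'a::field_char_0 \<Rightarrow> 'a \<Rightarrow> nat \<Rightarrow> 'a fps" where
  "eulerian2_series s t n = fps_X * fps_exp (s - 1) * fps_of_poly (eulerian2_poly s t n)
     * one_minus_X_neg_powr (2 * of_nat n + s + t)"

text \<open>
  The differential equation \<open>F (n + 1) = X / (1 - X) F' n + (s - 1) F n\<close>, multiplied by
  \<open>1 - X\<close>.  Differentiating the product \<open>F n\<close> and dividing by \<open>X exp ((s-1) X)\<close> and the power
  of \<open>1 - X\<close> reduces it to the recurrence of the polynomials.
\<close>

lemma eulerian2_series_Suc:
  "(1 - fps_X) * eulerian2_series s t (Suc n)
     = fps_X * fps_deriv (eulerian2_series s t n)
       + fps_const (s - 1) * ((1 - fps_X) * eulerian2_series s t n)"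
proof -
  \<comment> \<open>\<open>Q\<close> is the power of \<open>1 - X\<close> in \<open>F (n + 1)\<close>; every other power is a multiple of it by a
     polynomial, after which the claim is a ring identity.\<close>
  define B where "B = fps_of_poly (eulerian2_poly s t n)"
  define a where "a = 2 * of_nat n + s + t"
  define Q where "Q = one_minus_X_neg_powr (a + 2)"
  have P1: "one_minus_X_neg_powr (a + 1) = (1 - fps_X) * Q"
    using one_minus_X_neg_powr_plus_1[of "a + 1"] by (simp add: Q_def add.assoc)
  have P0: "one_minus_X_neg_powr a = (1 - fps_X) * ((1 - fps_X) * Q)"
    using one_minus_X_neg_powr_plus_1[of a] P1 by simp
  have dP: "fps_deriv (one_minus_X_neg_powr a) = fps_const a * ((1 - fps_X) * Q)"
    by (simp add: fps_deriv_one_minus_X_neg_powr P1)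
  have F: "eulerian2_series s t n = fps_X * fps_exp (s - 1) * B * one_minus_X_neg_powr a"
    by (simp add: eulerian2_series_def B_def a_def)
  have "2 * of_nat (Suc n) + s + t = a + 2"
    by (simp add: a_def)
  then have F_Suc: "eulerian2_series s t (Suc n) = fps_X * fps_exp (s - 1)
      * (fps_X * (1 - fps_X) * fps_deriv B + fps_const s * B
         + fps_const (2 * of_nat n + t) * (fps_X * B)) * Q"
    by (simp only: eulerian2_series_def fps_of_eulerian2_poly_Suc Q_def B_def)
  have dF: "fps_deriv (eulerian2_series s t n)
      = fps_exp (s - 1) * B * one_minus_X_neg_powr a
        + fps_X * (fps_const (s - 1) * fps_exp (s - 1)) * B * one_minus_X_neg_powr a
        + fps_X * fps_exp (s - 1) * fps_deriv B * one_minus_X_neg_powr a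
        + fps_X * fps_exp (s - 1) * B * (fps_const a * ((1 - fps_X) * Q))"
    unfolding F by (simp add: dP algebra_simps)
  have ca: "fps_const a = fps_const (2 * of_nat n + t) + fps_const s"
    and cs: "fps_const (s - 1) = fps_const s - 1"
    by (simp_all add: a_def add_ac flip: fps_const_sub)
  show ?thesis
    unfolding dF unfolding F_Suc F P0 ca cs by algebra
qed

section \<open>The recurrence of the Abel-type coefficients\<close>

definition abel_series :: "'a::field_char_0 \<Rightarrow> 'a \<Rightarrow> nat \<Rightarrow> 'a fps" where
  "abel_series s t n = Abs_fps (\<lambda>k. if k = 0 then 0 else
     1 / fact (k - 1) * (\<Sum>j=0..k - 1. of_nat ((k - 1) choose j)
       * pochhammer (s + t) j * abel_factor s n k j))"

lemma series_term_eq: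
  "series_term s t n (Suc k) = fps_const (abel_series s t n $ Suc k) * tree_arg ^ Suc k"
  by (simp add: series_term_def abel_series_def tree_arg_def mult_ac flip: fps_const_mult)

lemma abel_series_Suc:
  "abel_series s t (Suc n)
     = fps_X * fps_deriv (abel_series s t n) + fps_const (s - 1) * abel_series s t n"
proof (rule fps_ext)
  fix k
  \<comment> \<open>The exponent \<open>-1\<close> at \<open>n = 0\<close>, \<open>j = k - 1\<close> is no exception: the product read as \<open>1\<close>
     is followed at \<open>n = 1\<close> by \<open>s + k - 1\<close>.\<close>
  show "abel_series s t (Suc n) $ k
     = (fps_X * fps_deriv (abel_series s t n) + fps_const (s - 1) * abel_series s t n) $ k"
  proof (cases k)
    case 0
    then show ?thesis
      by (simp add: abel_series_def)
  next
    case (Suc i)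
    have step: "abel_factor s (Suc n) (Suc i) j = (of_nat i + s) * abel_factor s n (Suc i) j"
      if "j \<le> i" for j
    proof (cases "n = 0 \<and> j = i")
      case False
      with that have "Suc n + Suc i - j - 2 = Suc (n + Suc i - j - 2)"
        by auto
      moreover have "abel_factor s n (Suc i) j
          = (s + of_nat j) * (of_nat (Suc i) + s - 1) ^ (n + Suc i - j - 2)"
        using False by (auto simp only: abel_factor_def diff_Suc_1 if_False)
      ultimately show ?thesis
        by (simp add: abel_factor_def)
    qed (simp add: abel_factor_def)
    have "abel_series s t (Suc n) $ Suc i = (of_nat i + s) * abel_series s t n $ Suc i"
      by (simp add: abel_series_def step sum_distrib_left mult_ac)
    then show ?thesis
      by (simp add: Suc fps_X_mult_nth algebra_simps)
  qed
qed

section \<open>The case n = 0 and the induction\<close>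

text \<open>
  The coefficients of the infinite sum of the series \<open>(s+t)^(j) / j! * X^(j+1) * abel_exp (s + j)\<close>
  with rising factorial \<open>(s+t)^(j)\<close>.  The bound \<open>N\<close> is left free, so that it does not depend on
  \<open>k\<close> and the sums over \<open>k\<close> and \<open>j\<close> can be exchanged below.
\<close>

lemma abel_series_0_nth:
  fixes s t :: "'a::field_char_0"
  assumes "k \<le> N"
  shows "abel_series s t 0 $ k
     = (\<Sum>j\<le>N. pochhammer (s + t) j / fact j * (fps_X ^ Suc j * abel_exp (s + of_nat j)) $ k)"
proof (cases k)
  case 0
  then show ?thesis
    by (simp add: abel_series_def fps_X_power_mult_nth del: power_Suc)
next
  case (Suc i)
  have factor: "1 / fact i * (of_nat (i choose j) * pochhammer (s + t) j * abel_factor s 0 (Suc i) j)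
      = pochhammer (s + t) j / fact j * abel_exp (s + of_nat j) $ (i - j)" if "j \<le> i" for j
  proof -
    have choose: "of_nat (i choose j) = (fact i / (fact j * fact (i - j)) :: 'a)"
      using that by (rule binomial_fact)
    have "abel_factor s 0 (Suc i) j = fact (i - j) * abel_exp (s + of_nat j) $ (i - j)"
      using that by (auto simp: abel_factor_def abel_exp_def of_nat_diff add_ac)
    then show ?thesis
      by (simp add: choose divide_simps)
  qed
  have "abel_series s t 0 $ k
      = (\<Sum>j\<le>i. pochhammer (s + t) j / fact j * abel_exp (s + of_nat j) $ (i - j))"
    unfolding Suc abel_series_def
    by (simp add: sum_distrib_left atLeast0AtMost factor del: mult_1 times_divide_eq_left)
  also have "\<dots> = (\<Sum>j\<le>N. pochhammer (s + t) j / fact j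
      * (fps_X ^ Suc j * abel_exp (s + of_nat j)) $ k)"
    using assms Suc
    by (intro sum.mono_neutral_cong_left) (auto simp: fps_X_power_mult_nth simp del: power_Suc)
  finally show ?thesis .
qed

lemma abel_series_0_compose: "abel_series s t 0 oo tree_arg = eulerian2_series s t 0"
proof (rule fps_ext)
  fix N
  let ?p = "\<lambda>j. pochhammer (s + t) j / fact j"
  have poly0: "fps_of_poly (eulerian2_poly s t 0) = 1"
    by (simp add: eulerian2_poly_def)
  have comp: "(fps_X ^ Suc j * abel_exp (s + of_nat j)) oo tree_arg
      = fps_X ^ Suc j * fps_exp (s - 1)" for j
  proof -
    have "(fps_X ^ Suc j * abel_exp (s + of_nat j)) oo tree_arg
        = tree_arg ^ Suc j * fps_exp (s + of_nat j)"
      by (simp add: fps_compose_mult_distrib fps_compose_power abel_exp_compose_tree_arg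
          del: power_Suc flip: fps_compose_power)
    also have "\<dots> = fps_X ^ Suc j * (fps_exp (- of_nat (Suc j)) * fps_exp (s + of_nat j))"
      by (simp add: tree_arg_def power_mult_distrib fps_exp_power_mult mult.assoc del: power_Suc)
    also have "fps_exp (- of_nat (Suc j)) * fps_exp (s + of_nat j) = fps_exp (s - 1)"
      by (simp flip: fps_exp_add_mult)
    finally show ?thesis .
  qed
  have "(abel_series s t 0 oo tree_arg) $ N = (\<Sum>k\<le>N. (\<Sum>j\<le>N. ?p j
      * (fps_X ^ Suc j * abel_exp (s + of_nat j)) $ k) * (tree_arg ^ k) $ N)"
    by (simp add: fps_compose_nth atLeast0AtMost abel_series_0_nth[where N = N] del: power_Suc)
  also have "\<dots> = (\<Sum>j\<le>N. ?p j * ((fps_X ^ Suc j * abel_exp (s + of_nat j)) oo tree_arg) $ N)"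
    unfolding fps_compose_nth atLeast0AtMost sum_distrib_left sum_distrib_right
    by (subst sum.swap) (simp only: mult.assoc)
  also have "\<dots> = (\<Sum>j\<le>N. ?p j * (fps_X ^ j * (fps_X * fps_exp (s - 1))) $ N)"
    by (simp only: comp) (simp only: power_Suc2 mult.assoc)
  also have "\<dots> = (one_minus_X_neg_powr (s + t) * (fps_X * fps_exp (s - 1))) $ N"
    unfolding fps_mult_nth[of "one_minus_X_neg_powr (s + t)"] atLeast0AtMost
    by (intro sum.cong refl) (simp only: fps_X_power_mult_nth one_minus_X_neg_powr_nth, simp)
  finally show "(abel_series s t 0 oo tree_arg) $ N = eulerian2_series s t 0 $ N"
    by (simp add: eulerian2_series_def poly0 mult_ac)
qed

lemma abel_series_compose: "abel_series s t n oo tree_arg = eulerian2_series s t n"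
proof (induction n)
  case (Suc n)
  have "(1 - fps_X) * (abel_series s t (Suc n) oo tree_arg)
      = (1 - fps_X) * eulerian2_series s t (Suc n)"
    unfolding abel_series_Suc eulerian2_series_Suc
    by (simp add: fps_compose_add_distrib distrib_left compose_theta Suc.IH mult_ac
      fps_compose_mult_distrib[of tree_arg "fps_const (s - 1)"])
  moreover have "1 - fps_X \<noteq> (0 :: 'a fps)"
    using one_minus_X_inverse by auto
  ultimately show ?case
    by simp
qed (rule abel_series_0_compose)

theorem proposition14:
  fixes s t :: "'a::field_char_0" and n :: nat
  shows "(\<lambda>k. series_term s t n (Suc k)) sums
           (fps_X * fps_exp (s - 1) * fps_of_poly (eulerian2_poly s t n)
            * one_minus_X_neg_powr (2 * of_nat n + s + t))"
proof -
  have "abel_series s t n $ 0 = 0"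
    by (simp add: abel_series_def)
  from fps_compose_sums_shifted[OF this tree_arg_nth_0]
  show ?thesis
    unfolding series_term_eq abel_series_compose eulerian2_series_def .
qed

end
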